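(* Let $k\ge1$ and let $S_1,\dots,S_{k+1}\in\mathbb{V}(X)$ be sets with $S_1,\dots,S_k$ completely coherent. For every $i\le k+1$ let $\mathcal{U}_i\in\beta S_i$ and $\alpha_i\in\mu_1(\mathcal{U}_i)$. Then $(\alpha_1,{}^{\ast}\alpha_2,\dots,S_k(\alpha_{k+1}))$, i.e. the tuple whose $i$-th entry is $S_{i-1}(\alpha_i)$, belongs to $\mu_{k+1}(\mathcal{U}_1\otimes\dots\otimes\mathcal{U}_{k+1})$.
   Context: Work in a single superstructure model $\langle\mathbb{V}(X),\mathbb{V}(X),\ast\rangle$ of nonstandard methods ($\ast$ a star map satisfying transfer). Define $S_0=\mathrm{id}$, $S_{n+1}=\ast\circ S_n$. For an ultrafilter $\mathcal{W}$ on $Y$, $\mu_n(\mathcal{W})=\bigcap_{A\in\mathcal{W}}S_n(A)$. A set $Y$ is completely coherent if $A\subseteq{}^{\ast}A$ for all $A\subseteq Y$. The tensor product $\mathcal{U}_1\otimes\dots\otimes\mathcal{U}_{k+1}$ is the ultrafilter on $S_1\times\dots\times S_{k+1}$ with $A\in\mathcal{U}_1\otimes\dots\otimes\mathcal{U}_{k+1}$ iff $\{s_1\mid\{s_2\mid\dots\{s_{k+1}\mid(s_1,\dots,s_{k+1})\in A\}\in\mathcal{U}_{k+1}\}\dots\}\in\mathcal{U}_1$. *)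

theory Defs
  imports Main
begin

text \<open>The type \<^typ>\<open>'v\<close> is the superstructure \<open>V(X)\<close> itself: \<open>X\<close> is the set of atoms (every other
  element is a set) and \<open>elts v\<close> is the collection of members of \<open>v\<close>. The locale assumptions
  determine \<open>V(X)\<close> up to isomorphism. Such a type cannot be constructed in HOL for infinite \<open>X\<close>
  (its cardinality is a limit of iterated power sets), so it is taken as a parameter.\<close>

locale atoms_and_members =
  fixes X :: "'v set" and elts :: "'v \<Rightarrow> 'v set"
begin

definition is_set :: "'v \<Rightarrow> bool" where
  "is_set v \<longleftrightarrow> v \<notin> X"

primrec level :: "nat \<Rightarrow> 'v set" where
  "level 0 = X"
| "level (Suc n) = level n \<union> {v. is_set v \<and> elts v \<subseteq> level n}"

end

locale superstructure = atoms_and_members X elts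
  for X :: "'v set" and elts :: "'v \<Rightarrow> 'v set" +
  assumes atom_elts: "x \<in> X \<Longrightarrow> elts x = {}"
    and extensionality: "\<lbrakk>is_set u; is_set v; elts u = elts v\<rbrakk> \<Longrightarrow> u = v"
    and power_full: "A \<subseteq> level n \<Longrightarrow> \<exists>v. is_set v \<and> elts v = A"
    and exhausted: "(\<Union>n. level n) = UNIV"
begin

text \<open>The element of \<open>V(X)\<close> with the given members; meaningful when these lie in a common level.\<close>

definition vset :: "'v set \<Rightarrow> 'v" where
  "vset A = (THE v. is_set v \<and> elts v = A)"

definition subset_of :: "'v \<Rightarrow> 'v \<Rightarrow> bool" where
  "subset_of A B \<longleftrightarrow> is_set A \<and> elts A \<subseteq> elts B"

definition vpair :: "'v \<Rightarrow> 'v \<Rightarrow> 'v" where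
  "vpair a b = vset {vset {a}, vset {a, b}}"

text \<open>Tuples are nested Kuratowski pairs \<open>(a\<^sub>1, (a\<^sub>2, \<dots>))\<close>, with the \<open>1\<close>-tuple of \<open>a\<close> being \<open>a\<close>.
  Only nonempty tuples are meaningful.\<close>

fun tuple :: "'v list \<Rightarrow> 'v" where
  "tuple [] = vset {}"
| "tuple [a] = a"
| "tuple (a # b # as) = vpair a (tuple (b # as))"

definition vprod :: "'v list \<Rightarrow> 'v" where
  "vprod Ss = vset {tuple as | as. list_all2 (\<lambda>a S. a \<in> elts S) as Ss}"

definition ultrafilter_on :: "'v \<Rightarrow> 'v \<Rightarrow> bool" where
  "ultrafilter_on S U \<longleftrightarrow>
     is_set U \<and> (\<forall>A\<in>elts U. subset_of A S) \<and>
     S \<in> elts U \<and> vset {} \<notin> elts U \<and>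
     (\<forall>A\<in>elts U. \<forall>B\<in>elts U. vset (elts A \<inter> elts B) \<in> elts U) \<and>
     (\<forall>A\<in>elts U. \<forall>B. subset_of B S \<and> elts A \<subseteq> elts B \<longrightarrow> B \<in> elts U) \<and>
     (\<forall>A. subset_of A S \<longrightarrow> A \<in> elts U \<or> vset (elts S - elts A) \<in> elts U)"

definition beta :: "'v \<Rightarrow> 'v set" where
  "beta S = {U. ultrafilter_on S U}"

text \<open>\<open>large [S\<^sub>1, \<dots>, S\<^sub>n] [U\<^sub>1, \<dots>, U\<^sub>n] P\<close> says
  \<open>{s\<^sub>1 \<in> S\<^sub>1 | \<dots> {s\<^sub>n \<in> S\<^sub>n | P [s\<^sub>1, \<dots>, s\<^sub>n]} \<in> U\<^sub>n \<dots>} \<in> U\<^sub>1\<close>. Lists of different lengths are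
  never passed to it.\<close>

fun large :: "'v list \<Rightarrow> 'v list \<Rightarrow> ('v list \<Rightarrow> bool) \<Rightarrow> bool" where
  "large (S # Ss) (U # Us) P \<longleftrightarrow>
     vset {s \<in> elts S. large Ss Us (\<lambda>as. P (s # as))} \<in> elts U"
| "large _ _ P \<longleftrightarrow> P []"

definition tensor :: "'v list \<Rightarrow> 'v list \<Rightarrow> 'v" where
  "tensor Ss Us =
     vset {A. subset_of A (vprod Ss) \<and> large Ss Us (\<lambda>as. tuple as \<in> elts A)}"

end

text \<open>Bounded quantifier formulas of the language of set theory, with variables indexed by
  \<^typ>\<open>nat\<close>; \<open>BAll i j \<phi>\<close> is \<open>\<forall>x\<^sub>i \<in> x\<^sub>j. \<phi>\<close>. The remaining connectives and the bounded existential
  quantifier are definable.\<close>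

datatype bformula =
    Equal nat nat
  | Member nat nat
  | Neg bformula
  | Conj bformula bformula
  | BAll nat nat bformula

primrec sat :: "('v \<Rightarrow> 'v set) \<Rightarrow> (nat \<Rightarrow> 'v) \<Rightarrow> bformula \<Rightarrow> bool" where
  "sat elts e (Equal i j) \<longleftrightarrow> e i = e j"
| "sat elts e (Member i j) \<longleftrightarrow> e i \<in> elts (e j)"
| "sat elts e (Neg \<phi>) \<longleftrightarrow> \<not> sat elts e \<phi>"
| "sat elts e (Conj \<phi> \<psi>) \<longleftrightarrow> sat elts e \<phi> \<and> sat elts e \<psi>"
| "sat elts e (BAll i j \<phi>) \<longleftrightarrow> (\<forall>a\<in>elts (e j). sat elts (e(i := a)) \<phi>)"

locale single_superstructure_model = superstructure X elts
  for X :: "'v set" and elts :: "'v \<Rightarrow> 'v set" +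
  fixes star :: "'v \<Rightarrow> 'v"
  assumes transfer: "sat elts e \<phi> \<longleftrightarrow> sat elts (\<lambda>i. star (e i)) \<phi>"
begin

definition iter_star :: "nat \<Rightarrow> 'v \<Rightarrow> 'v" where
  "iter_star n = star ^^ n"

definition mu :: "nat \<Rightarrow> 'v \<Rightarrow> 'v set" where
  "mu n W = (\<Inter>A\<in>elts W. elts (iter_star n A))"

definition completely_coherent :: "'v \<Rightarrow> bool" where
  "completely_coherent Y \<longleftrightarrow> (\<forall>A. subset_of A Y \<longrightarrow> elts A \<subseteq> elts (star A))"

end

context superstructure
begin

lemma level_mono: "m \<le> n \<Longrightarrow> level m \<subseteq> level n"
  by (induction n) (auto simp: le_Suc_eq)

lemma elts_level: "v \<in> level n \<Longrightarrow> elts v \<subseteq> level n"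
  by (induction n) (auto simp: atom_elts)

lemma vset_bounded:
  assumes "A \<subseteq> level n"
  shows "is_set (vset A)" "elts (vset A) = A"
proof -
  obtain v where v: "is_set v" "elts v = A"
    using power_full assms by blast
  then have "vset A = v"
    unfolding vset_def by (auto intro!: the_equality extensionality)
  with v show "is_set (vset A)" "elts (vset A) = A"
    by auto
qed

lemma vset_in_level: "A \<subseteq> level n \<Longrightarrow> vset A \<in> level (Suc n)"
  using vset_bounded[of A n] by simp

lemma vset_elts: "is_set v \<Longrightarrow> vset (elts v) = v"
  unfolding vset_def by (auto intro!: the_equality extensionality)

lemma elts_bounded: "\<exists>n. elts v \<subseteq> level n"
  using exhausted elts_level by blast

lemma vset_sub:
  assumes "A \<subseteq> elts v"
  shows "is_set (vset A)" "elts (vset A) = A"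
proof -
  obtain n where "elts v \<subseteq> level n"
    using elts_bounded by blast
  then have "A \<subseteq> level n"
    using assms by simp
  from vset_bounded[OF this] show "is_set (vset A)" "elts (vset A) = A" .
qed

lemma vpair_in_level:
  assumes "a \<in> level n" "b \<in> level n"
  shows "vpair a b \<in> level (n + 2)"
proof -
  have "vset {a} \<in> level (Suc n)" "vset {a, b} \<in> level (Suc n)"
    using assms by (auto intro!: vset_in_level simp del: level.simps)
  then have "vpair a b \<in> level (Suc (Suc n))"
    unfolding vpair_def by (intro vset_in_level) auto
  then show ?thesis by simp
qed

lemma common_level: "\<exists>n. a \<in> level n \<and> b \<in> level n"
proof -
  obtain m k where "a \<in> level m" "b \<in> level k"
    using exhausted by blast
  then have "a \<in> level (max m k)" "b \<in> level (max m k)"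
    using level_mono[of m "max m k"] level_mono[of k "max m k"] by auto
  then show ?thesis by blast
qed

lemma elts_vset_finite2: "elts (vset {a, b}) = {a, b}"
proof -
  obtain n where "a \<in> level n" "b \<in> level n"
    using common_level by blast
  then have "{a, b} \<subseteq> level n" by simp
  then show ?thesis by (rule vset_bounded)
qed

lemma vpair_inject: "vpair a b = vpair c d \<longleftrightarrow> a = c \<and> b = d"
proof
  assume "vpair a b = vpair c d"
  then have eq: "{vset {a}, vset {a, b}} = {vset {c}, vset {c, d}}"
    unfolding vpair_def using elts_vset_finite2 by metis
  have "elts ` {vset {a}, vset {a, b}} = elts ` {vset {c}, vset {c, d}}"
    by (simp only: eq)
  then have "{{a}, {a, b}} = {{c}, {c, d}}"
    using elts_vset_finite2[of a a] elts_vset_finite2[of c c]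
    by (simp add: elts_vset_finite2)
  then show "a = c \<and> b = d"
    by (auto simp: doubleton_eq_iff)
qed simp

lemma tuple_inject: "\<lbrakk>length as = length bs; tuple as = tuple bs\<rbrakk> \<Longrightarrow> as = bs"
proof (induction as arbitrary: bs rule: tuple.induct)
  case (2 a)
  then show ?case by (cases bs) auto
next
  case (3 a b as)
  then obtain c d bs' where bs: "bs = c # d # bs'"
    by (cases bs; cases "tl bs") auto
  then have "a = c" "tuple (b # as) = tuple (d # bs')" "length (b # as) = length (d # bs')"
    using "3.prems" by (simp_all add: vpair_inject)
  then show ?case using "3.IH"[of "d # bs'"] bs by simp
qed simp

lemma tuples_bounded:
  "\<exists>n. {tuple as | as. list_all2 (\<lambda>a S. a \<in> elts S) as Ss} \<subseteq> level n"
proof (induction Ss)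
  case Nil
  show ?case using exhausted by auto
next
  case (Cons S Ss)
  obtain n where n: "elts S \<subseteq> level n"
    using elts_bounded by blast
  obtain m where m: "{tuple as | as. list_all2 (\<lambda>a S. a \<in> elts S) as Ss} \<subseteq> level m"
    using Cons by blast
  define N where "N = max m n"
  have N: "level m \<subseteq> level N" "level n \<subseteq> level N" "level N \<subseteq> level (N + 2)"
    by (rule level_mono, simp add: N_def max_def)+
  have "tuple as \<in> level (N + 2)" if as: "list_all2 (\<lambda>a S. a \<in> elts S) as (S # Ss)" for as
  proof -
    obtain a as' where a: "as = a # as'" "a \<in> elts S" "list_all2 (\<lambda>a S. a \<in> elts S) as' Ss"
      using as by (auto simp: list_all2_Cons2)
    have aN: "a \<in> level N" "tuple as' \<in> level N"
      using a n m N by blast+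
    show ?thesis
    proof (cases as')
      case Nil
      then show ?thesis using a aN N by auto
    next
      case (Cons b bs)
      then show ?thesis using a vpair_in_level[OF aN] by simp
    qed
  qed
  then show ?case by blast
qed

lemma is_set_vprod: "is_set (vprod Ss)"
  and elts_vprod: "elts (vprod Ss) = {tuple as | as. list_all2 (\<lambda>a S. a \<in> elts S) as Ss}"
proof -
  obtain n where "{tuple as | as. list_all2 (\<lambda>a S. a \<in> elts S) as Ss} \<subseteq> level n"
    using tuples_bounded by blast
  from vset_bounded[OF this] show "is_set (vprod Ss)"
    "elts (vprod Ss) = {tuple as | as. list_all2 (\<lambda>a S. a \<in> elts S) as Ss}"
    unfolding vprod_def .
qed

lemma is_set_tensor: "is_set (tensor Ss Us)"
  and elts_tensor: "elts (tensor Ss Us) =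
    {A. subset_of A (vprod Ss) \<and> large Ss Us (\<lambda>as. tuple as \<in> elts A)}"
proof -
  obtain n where "elts (vprod Ss) \<subseteq> level n"
    using elts_bounded by blast
  then have "{A. subset_of A (vprod Ss) \<and> large Ss Us (\<lambda>as. tuple as \<in> elts A)} \<subseteq> level (Suc n)"
    by (auto simp: subset_of_def)
  from vset_bounded[OF this] show "is_set (tensor Ss Us)" "elts (tensor Ss Us) =
    {A. subset_of A (vprod Ss) \<and> large Ss Us (\<lambda>as. tuple as \<in> elts A)}"
    by (simp_all add: tensor_def)
qed

lemma ultrafilter_mono:
  assumes "ultrafilter_on S U" "vset {s \<in> elts S. P s} \<in> elts U"
    and "\<And>s. \<lbrakk>s \<in> elts S; P s\<rbrakk> \<Longrightarrow> Q s"
  shows "vset {s \<in> elts S. Q s} \<in> elts U"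
proof -
  have "subset_of (vset {s \<in> elts S. Q s}) S"
    "elts (vset {s \<in> elts S. P s}) \<subseteq> elts (vset {s \<in> elts S. Q s})"
    using vset_sub[of "{s \<in> elts S. Q s}" S] vset_sub[of "{s \<in> elts S. P s}" S] assms(3)
    by (auto simp: subset_of_def)
  then show ?thesis using assms(1,2) unfolding ultrafilter_on_def by blast
qed

lemma ultrafilter_conj:
  assumes "ultrafilter_on S U" "vset {s \<in> elts S. P s} \<in> elts U"
    "vset {s \<in> elts S. Q s} \<in> elts U"
  shows "vset {s \<in> elts S. P s \<and> Q s} \<in> elts U"
proof -
  have "vset (elts (vset {s \<in> elts S. P s}) \<inter> elts (vset {s \<in> elts S. Q s})) \<in> elts U"
    using assms unfolding ultrafilter_on_def by blast
  moreover have "elts (vset {s \<in> elts S. P s}) \<inter> elts (vset {s \<in> elts S. Q s})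
      = {s \<in> elts S. P s \<and> Q s}"
    using vset_sub[of "{s \<in> elts S. Q s}" S] vset_sub[of "{s \<in> elts S. P s}" S] by auto
  ultimately show ?thesis by simp
qed

lemma ultrafilter_neg:
  assumes "ultrafilter_on S U" "vset {s \<in> elts S. P s} \<notin> elts U"
  shows "vset {s \<in> elts S. \<not> P s} \<in> elts U"
proof -
  have "subset_of (vset {s \<in> elts S. P s}) S"
    "elts S - elts (vset {s \<in> elts S. P s}) = {s \<in> elts S. \<not> P s}"
    using vset_sub[of "{s \<in> elts S. P s}" S] by (auto simp: subset_of_def)
  moreover have "\<forall>A. subset_of A S \<longrightarrow> A \<in> elts U \<or> vset (elts S - elts A) \<in> elts U"
    using assms(1) unfolding ultrafilter_on_def by blast
  ultimately show ?thesis using assms(2) by metis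
qed

lemma large_mono:
  assumes "list_all2 ultrafilter_on Ss Us" "large Ss Us P"
    and "\<And>as. \<lbrakk>list_all2 (\<lambda>a S. a \<in> elts S) as Ss; P as\<rbrakk> \<Longrightarrow> Q as"
  shows "large Ss Us Q"
  using assms
proof (induction Ss Us arbitrary: P Q rule: list_all2_induct)
  case (Cons S Ss U Us)
  have "large Ss Us (\<lambda>as. Q (s # as))"
    if "s \<in> elts S" "large Ss Us (\<lambda>as. P (s # as))" for s
    using that(2) by (rule Cons.IH) (auto intro: Cons.prems(2) that(1))
  then show ?case
    using ultrafilter_mono[OF Cons.hyps(1) Cons.prems(1)[unfolded large.simps]] by simp
qed simp

lemma large_conj:
  assumes "list_all2 ultrafilter_on Ss Us" "large Ss Us P" "large Ss Us Q"
  shows "large Ss Us (\<lambda>as. P as \<and> Q as)"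
  using assms
proof (induction Ss Us arbitrary: P Q rule: list_all2_induct)
  case (Cons S Ss U Us)
  have "vset {s \<in> elts S. large Ss Us (\<lambda>as. P (s # as)) \<and> large Ss Us (\<lambda>as. Q (s # as))}
      \<in> elts U"
    using ultrafilter_conj[OF Cons.hyps(1)] Cons.prems by simp
  then show ?case
    unfolding large.simps
    by (rule ultrafilter_mono[OF Cons.hyps(1)]) (rule Cons.IH, simp_all)
qed simp

lemma large_neg:
  assumes "list_all2 ultrafilter_on Ss Us" "\<not> large Ss Us P"
  shows "large Ss Us (\<lambda>as. \<not> P as)"
  using assms
proof (induction Ss Us arbitrary: P rule: list_all2_induct)
  case (Cons S Ss U Us)
  have "vset {s \<in> elts S. \<not> large Ss Us (\<lambda>as. P (s # as))} \<in> elts U"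
    using ultrafilter_neg[OF Cons.hyps(1)] Cons.prems by simp
  then show ?case
    unfolding large.simps by (rule ultrafilter_mono[OF Cons.hyps(1)]) (rule Cons.IH)
qed simp

lemma large_False:
  assumes "list_all2 ultrafilter_on Ss Us"
  shows "\<not> large Ss Us (\<lambda>_. False)"
  using assms
  by (induction Ss Us rule: list_all2_induct) (auto simp: ultrafilter_on_def)

lemma tensor_ultrafilter:
  assumes "list_all2 ultrafilter_on Ss Us"
  shows "tensor Ss Us \<in> beta (vprod Ss)"
proof -
  note mono = large_mono[OF assms]
  note sub = vset_sub[where v = "vprod Ss"]
  have tup: "tuple as \<in> elts (vprod Ss)" if "list_all2 (\<lambda>a S. a \<in> elts S) as Ss" for as
    using that elts_vprod by blast
  have all: "large Ss Us (\<lambda>as. tuple as \<in> elts (vprod Ss))"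
    using large_neg[OF assms large_False[OF assms]] tup by (rule mono)
  have empty: "\<not> large Ss Us (\<lambda>as. tuple as \<in> elts (vset {}))"
    using large_False[OF assms] sub(2)[of "{}"] by simp
  have inter: "vset (elts A \<inter> elts B) \<in> elts (tensor Ss Us)"
    if "A \<in> elts (tensor Ss Us)" "B \<in> elts (tensor Ss Us)" for A B
  proof -
    have "elts A \<inter> elts B \<subseteq> elts (vprod Ss)"
      using that by (auto simp: elts_tensor subset_of_def)
    from sub[OF this] show ?thesis
      using that large_conj[OF assms, of "\<lambda>as. tuple as \<in> elts A" "\<lambda>as. tuple as \<in> elts B"]
      by (auto simp: elts_tensor subset_of_def)
  qed
  have up: "B \<in> elts (tensor Ss Us)"
    if "A \<in> elts (tensor Ss Us)" "subset_of B (vprod Ss)" "elts A \<subseteq> elts B" for A B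
    using that mono[of "\<lambda>as. tuple as \<in> elts A" "\<lambda>as. tuple as \<in> elts B"]
    by (auto simp: elts_tensor)
  have max: "A \<in> elts (tensor Ss Us) \<or> vset (elts (vprod Ss) - elts A) \<in> elts (tensor Ss Us)"
    if "subset_of A (vprod Ss)" for A
  proof (cases "large Ss Us (\<lambda>as. tuple as \<in> elts A)")
    case False
    have "large Ss Us (\<lambda>as. tuple as \<in> elts (vprod Ss) - elts A)"
      using large_neg[OF assms False] by (rule mono) (auto intro: tup)
    then show ?thesis
      using sub[of "elts (vprod Ss) - elts A"] by (auto simp: elts_tensor subset_of_def)
  qed (use that in \<open>simp add: elts_tensor\<close>)
  show ?thesis
    unfolding beta_def ultrafilter_on_def mem_Collect_eq
  proof (intro conjI ballI allI impI)
    show "vprod Ss \<in> elts (tensor Ss Us)"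
      using all is_set_vprod by (simp add: elts_tensor subset_of_def)
    show "vset {} \<notin> elts (tensor Ss Us)"
      using empty by (simp add: elts_tensor)
  qed (use is_set_tensor inter up max in \<open>simp_all add: elts_tensor\<close>)
qed

end

end

theory Submission
  imports Defs
begin

text \<open>Coherence of \<open>S\<close> forces \<open>star s = s\<close> for every \<open>s\<close> in \<open>S\<close>: the singleton of \<open>s\<close> is
  contained in its own star, whose only member is \<open>star s\<close>. Let \<open>A\<close> be large for the tensor
  product, let \<open>B\<close> be the set of those \<open>s\<close> in \<open>S\<^sub>1\<close> whose section \<open>A\<^sub>s\<close> is large for the remaining
  factors, and let \<open>t\<close> be the tuple obtained for the remaining factors. By induction \<open>t\<close> lies in the
  \<open>k\<close>-fold star of every section \<open>A\<^sub>s\<close> with \<open>s\<close> in \<open>B\<close>; as \<open>s\<close> is fixed by \<open>star\<close>, this says that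
  \<open>(s, t)\<close> lies in the \<open>k\<close>-fold star of \<open>A\<close>. One more transfer, applied to this statement for all
  \<open>s\<close> in \<open>B\<close>, puts \<open>(\<alpha>\<^sub>1, star t)\<close> into the \<open>(k+1)\<close>-fold star of \<open>A\<close>.\<close>

abbreviation BEx :: "nat \<Rightarrow> nat \<Rightarrow> bformula \<Rightarrow> bformula" where
  "BEx i j \<phi> \<equiv> Neg (BAll i j (Neg \<phi>))"

abbreviation Disj :: "bformula \<Rightarrow> bformula \<Rightarrow> bformula" where
  "Disj \<phi> \<psi> \<equiv> Neg (Conj (Neg \<phi>) (Neg \<psi>))"

text \<open>Bound variables get an index above the sum of the free ones, which makes them fresh.\<close>

definition doubleton_formula :: "nat \<Rightarrow> nat \<Rightarrow> nat \<Rightarrow> bformula" where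
  "doubleton_formula p a b =
     (let z = Suc (p + a + b) in
       Conj (Member a p) (Conj (Member b p) (BAll z p (Disj (Equal z a) (Equal z b)))))"

definition pair_formula :: "nat \<Rightarrow> nat \<Rightarrow> nat \<Rightarrow> bformula" where
  "pair_formula p a b =
     (let u = Suc (p + a + b); v = Suc u in
       BEx u p (BEx v p (Conj (doubleton_formula p u v)
         (Conj (doubleton_formula u a a) (doubleton_formula v a b)))))"

definition product_subset_formula :: "nat \<Rightarrow> nat \<Rightarrow> nat \<Rightarrow> bformula" where
  "product_subset_formula b d a =
     (let x = Suc (b + d + a); y = Suc x; p = Suc y in
       BAll x b (BAll y d (BEx p a (pair_formula p x y))))"

context superstructure
begin

text \<open>Membership does not distinguish atoms from the empty set, but a nonempty collection of
  members identifies a set.\<close>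

lemma elts_eq_doubleton_iff: "elts p = {a, b} \<longleftrightarrow> p = vset {a, b}"
proof
  assume elts_p: "elts p = {a, b}"
  then have "is_set p"
    using atom_elts by (fastforce simp: is_set_def)
  then show "p = vset {a, b}"
    using vset_elts elts_p by metis
qed (simp add: elts_vset_finite2)

lemma elts_vset_singleton [simp]: "elts (vset {a}) = {a}"
  using elts_vset_finite2[of a a] by simp

lemma sat_doubleton_formula:
  "sat elts e (doubleton_formula p a b) \<longleftrightarrow> e p = vset {e a, e b}"
  unfolding elts_eq_doubleton_iff[symmetric]
  by (auto simp: doubleton_formula_def Let_def)

lemma sat_pair_formula: "sat elts e (pair_formula p a b) \<longleftrightarrow> e p = vpair (e a) (e b)"
  by (auto simp: pair_formula_def Let_def sat_doubleton_formula vpair_def elts_vset_finite2)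

lemma sat_product_subset_formula:
  "sat elts e (product_subset_formula b d a) \<longleftrightarrow>
     (\<forall>x\<in>elts (e b). \<forall>y\<in>elts (e d). vpair x y \<in> elts (e a))"
  by (auto simp: product_subset_formula_def Let_def sat_pair_formula)

definition vsection :: "'v \<Rightarrow> 'v \<Rightarrow> 'v" where
  "vsection A s = vset {x. vpair s x \<in> elts A}"

lemma vpair_in_levelD:
  assumes "vpair a b \<in> level n"
  shows "b \<in> level n"
proof -
  have "vset {a, b} \<in> elts (vpair a b)" "b \<in> elts (vset {a, b})"
    by (simp_all add: vpair_def elts_vset_finite2)
  with assms show ?thesis
    using elts_level by blast
qed

lemma is_set_vsection: "is_set (vsection A s)"
  and elts_vsection: "elts (vsection A s) = {x. vpair s x \<in> elts A}"
proof -
  obtain n where "elts A \<subseteq> level n"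
    using elts_bounded by blast
  then have "{x. vpair s x \<in> elts A} \<subseteq> level n"
    using vpair_in_levelD by blast
  from vset_bounded[OF this] show "is_set (vsection A s)"
    "elts (vsection A s) = {x. vpair s x \<in> elts A}"
    unfolding vsection_def .
qed

lemma tuple_Cons: "as \<noteq> [] \<Longrightarrow> tuple (a # as) = vpair a (tuple as)"
  by (cases as) simp_all

lemma elts_vprod_singleton: "elts (vprod [S]) = elts S"
  by (force simp: elts_vprod list_all2_Cons2)

lemma vpair_in_vprod_Cons_iff:
  assumes "Ss \<noteq> []"
  shows "vpair s x \<in> elts (vprod (S # Ss)) \<longleftrightarrow> s \<in> elts S \<and> x \<in> elts (vprod Ss)"
proof -
  have tuple_eq: "tuple (a # as) = vpair a (tuple as)"
    if "list_all2 (\<lambda>a S. a \<in> elts S) as Ss" for a as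
    using that assms by (intro tuple_Cons) auto
  have "vpair s x \<in> elts (vprod (S # Ss)) \<longleftrightarrow>
      (\<exists>a as. vpair s x = tuple (a # as) \<and> a \<in> elts S \<and> list_all2 (\<lambda>a S. a \<in> elts S) as Ss)"
    by (auto simp: elts_vprod list_all2_Cons2; blast)
  also have "\<dots> \<longleftrightarrow>
      (\<exists>a as. vpair s x = vpair a (tuple as) \<and> a \<in> elts S \<and> list_all2 (\<lambda>a S. a \<in> elts S) as Ss)"
    using tuple_eq by metis
  also have "\<dots> \<longleftrightarrow> s \<in> elts S \<and> x \<in> elts (vprod Ss)"
    by (auto simp: elts_vprod vpair_inject)
  finally show ?thesis .
qed

lemma large_cong:
  assumes "length Ss = length Us"
    and "\<And>as. list_all2 (\<lambda>a S. a \<in> elts S) as Ss \<Longrightarrow> P as \<longleftrightarrow> Q as"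
  shows "large Ss Us P \<longleftrightarrow> large Ss Us Q"
  using assms
proof (induction Ss Us arbitrary: P Q rule: list_induct2)
  case (Cons S Ss U Us)
  have "large Ss Us (\<lambda>as. P (s # as)) \<longleftrightarrow> large Ss Us (\<lambda>as. Q (s # as))" if "s \<in> elts S" for s
    using that by (intro Cons.IH Cons.prems) simp
  then have "{s \<in> elts S. large Ss Us (\<lambda>as. P (s # as))} =
      {s \<in> elts S. large Ss Us (\<lambda>as. Q (s # as))}"
    by blast
  then show ?case by simp
qed simp

lemma tensor_singleton_iff:
  "A \<in> elts (tensor [S] [U]) \<longleftrightarrow> subset_of A S \<and> A \<in> elts U"
proof -
  have "vset {s \<in> elts S. s \<in> elts A} = A" if "subset_of A S"
  proof -
    have "{s \<in> elts S. s \<in> elts A} = elts A"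
      using that by (auto simp: subset_of_def)
    then show ?thesis
      using that by (simp add: subset_of_def vset_elts)
  qed
  then show ?thesis
    by (auto simp: elts_tensor subset_of_def elts_vprod_singleton)
qed

lemma tensor_Cons_iff:
  assumes "length Ss = length Us" "Ss \<noteq> []"
  shows "A \<in> elts (tensor (S # Ss) (U # Us)) \<longleftrightarrow>
    subset_of A (vprod (S # Ss)) \<and>
    vset {s \<in> elts S. vsection A s \<in> elts (tensor Ss Us)} \<in> elts U"
proof -
  have "large Ss Us (\<lambda>as. tuple (s # as) \<in> elts A) \<longleftrightarrow> vsection A s \<in> elts (tensor Ss Us)"
    if A_subset: "subset_of A (vprod (S # Ss))" for s
  proof -
    have "subset_of (vsection A s) (vprod Ss)"
      using A_subset vpair_in_vprod_Cons_iff[OF \<open>Ss \<noteq> []\<close>]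
      by (auto simp: subset_of_def is_set_vsection elts_vsection)
    moreover have "large Ss Us (\<lambda>as. tuple (s # as) \<in> elts A) \<longleftrightarrow>
        large Ss Us (\<lambda>as. tuple as \<in> elts (vsection A s))"
    proof (intro large_cong)
      fix as assume "list_all2 (\<lambda>a S. a \<in> elts S) as Ss"
      then have "as \<noteq> []"
        using \<open>Ss \<noteq> []\<close> by auto
      then show "tuple (s # as) \<in> elts A \<longleftrightarrow> tuple as \<in> elts (vsection A s)"
        by (simp add: elts_vsection tuple_Cons)
    qed (fact \<open>length Ss = length Us\<close>)
    ultimately show ?thesis
      by (simp add: elts_tensor)
  qed
  then show ?thesis
    by (auto simp: elts_tensor)
qed

end

context single_superstructure_model
begin

lemma star_vset_doubleton: "star (vset {a, b}) = vset {star a, star b}"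
proof -
  let ?e = "(\<lambda>_. vset {a, b})(1 := a, 2 := b)"
  have "sat elts ?e (doubleton_formula 0 1 2)"
    by (simp add: sat_doubleton_formula)
  then have "sat elts (\<lambda>i. star (?e i)) (doubleton_formula 0 1 2)"
    by (subst (asm) transfer)
  then show ?thesis
    by (simp add: sat_doubleton_formula)
qed

lemma star_vset_singleton: "star (vset {a}) = vset {star a}"
  using star_vset_doubleton[of a a] by simp

lemma star_product_subset:
  assumes "\<forall>x\<in>elts B. \<forall>y\<in>elts D. vpair x y \<in> elts A"
  shows "\<forall>x\<in>elts (star B). \<forall>y\<in>elts (star D). vpair x y \<in> elts (star A)"
proof -
  let ?e = "(\<lambda>_. A)(0 := B, 1 := D)"
  have "sat elts ?e (product_subset_formula 0 1 2)"
    using assms by (simp add: sat_product_subset_formula)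
  then have "sat elts (\<lambda>i. star (?e i)) (product_subset_formula 0 1 2)"
    by (subst (asm) transfer)
  then show ?thesis
    by (simp add: sat_product_subset_formula)
qed

lemma star_vpair: "star (vpair a b) = vpair (star a) (star b)"
  by (simp add: vpair_def star_vset_doubleton star_vset_singleton)

lemma star_tuple: "as \<noteq> [] \<Longrightarrow> star (tuple as) = tuple (map star as)"
  by (induction as rule: tuple.induct) (simp_all add: star_vpair)

lemma iter_star_0 [simp]: "iter_star 0 a = a"
  by (simp add: iter_star_def)

lemma iter_star_Suc [simp]: "iter_star (Suc n) a = star (iter_star n a)"
  by (simp add: iter_star_def)

lemma iter_star_add: "iter_star (m + n) a = iter_star m (iter_star n a)"
  by (simp add: iter_star_def funpow_add)

lemma iter_star_vset_singleton: "iter_star n (vset {a}) = vset {iter_star n a}"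
  by (induction n) (simp_all add: star_vset_singleton)

lemma iter_star_product_subset:
  assumes "\<forall>x\<in>elts B. \<forall>y\<in>elts D. vpair x y \<in> elts A"
  shows "\<forall>x\<in>elts (iter_star n B). \<forall>y\<in>elts (iter_star n D). vpair x y \<in> elts (iter_star n A)"
proof (induction n)
  case 0
  show ?case using assms by simp
next
  case (Suc n)
  then show ?case using star_product_subset by simp
qed

lemma iter_star_vsection:
  assumes "x \<in> elts (iter_star n (vsection A s))"
  shows "vpair (iter_star n s) x \<in> elts (iter_star n A)"
  using assms iter_star_product_subset[of "vset {s}" "vsection A s" A n]
  by (simp add: elts_vsection iter_star_vset_singleton)

lemma completely_coherent_star_fixed:
  assumes "completely_coherent S" "s \<in> elts S"
  shows "star s = s"
proof -
  have "subset_of (vset {s}) S"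
    using assms(2) vset_sub[of "{s}" S] by (simp add: subset_of_def)
  then have "elts (vset {s}) \<subseteq> elts (star (vset {s}))"
    using assms(1) unfolding completely_coherent_def by blast
  then show ?thesis
    by (simp add: star_vset_singleton)
qed

lemma completely_coherent_iter_star_fixed:
  assumes "completely_coherent S" "s \<in> elts S"
  shows "iter_star n s = s"
  by (induction n) (simp_all add: completely_coherent_star_fixed[OF assms])

lemma in_mu_iff: "a \<in> mu n W \<longleftrightarrow> (\<forall>A\<in>elts W. a \<in> elts (iter_star n A))"
  by (simp add: mu_def)

lemma mu_subset_mu_tensor_singleton: "mu n U \<subseteq> mu n (tensor [S] [U])"
  by (auto simp: in_mu_iff tensor_singleton_iff)

lemma vpair_in_mu_tensor_Cons:
  assumes coherent: "completely_coherent S"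
    and lists: "length Ss = length Us" "Ss \<noteq> []"
    and a_mu: "a \<in> mu m U" and t_mu: "t \<in> mu n (tensor Ss Us)"
  shows "vpair a (iter_star m t) \<in> mu (m + n) (tensor (S # Ss) (U # Us))"
  unfolding in_mu_iff
proof
  fix A assume A_large: "A \<in> elts (tensor (S # Ss) (U # Us))"
  define B where "B = vset {s \<in> elts S. vsection A s \<in> elts (tensor Ss Us)}"
  have elts_B: "elts B = {s \<in> elts S. vsection A s \<in> elts (tensor Ss Us)}"
    unfolding B_def by (rule vset_sub(2)[of _ S]) auto
  have "vpair s t \<in> elts (iter_star n A)" if "s \<in> elts B" for s
  proof -
    have "s \<in> elts S" "vsection A s \<in> elts (tensor Ss Us)"
      using that by (simp_all add: elts_B)
    then have "t \<in> elts (iter_star n (vsection A s))" "iter_star n s = s"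
      using t_mu completely_coherent_iter_star_fixed[OF coherent] by (simp_all add: in_mu_iff)
    then show ?thesis
      using iter_star_vsection by metis
  qed
  then have "\<forall>x\<in>elts (iter_star m B).
      vpair x (iter_star m t) \<in> elts (iter_star m (iter_star n A))"
    using iter_star_product_subset[of B "vset {t}" "iter_star n A" m]
    by (simp add: iter_star_vset_singleton)
  moreover have "B \<in> elts U"
    using A_large lists unfolding B_def by (simp add: tensor_Cons_iff)
  then have "a \<in> elts (iter_star m B)"
    using a_mu by (simp add: in_mu_iff)
  ultimately show "vpair a (iter_star m t) \<in> elts (iter_star (m + n) A)"
    by (simp add: iter_star_add)
qed

primrec star_shifts :: "'v list \<Rightarrow> 'v list" where
  "star_shifts [] = []"
| "star_shifts (a # as) = a # map star (star_shifts as)"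

lemma star_shifts_eq_Nil_iff [simp]: "star_shifts as = [] \<longleftrightarrow> as = []"
  by (cases as) simp_all

lemma star_shifts_map_upt:
  "star_shifts (map a [m..<n]) = map (\<lambda>i. iter_star (i - m) (a i)) [m..<n]"
proof (induction "n - m" arbitrary: m)
  case (Suc d)
  then have "star_shifts (map a [Suc m..<n]) = map (\<lambda>i. iter_star (i - Suc m) (a i)) [Suc m..<n]"
    by simp
  moreover have "star (iter_star (i - Suc m) (a i)) = iter_star (i - m) (a i)" if "m < i" for i
    using that by (simp flip: iter_star_Suc add: Suc_diff_Suc)
  ultimately show ?case
    using Suc.hyps(2) by (simp add: upt_conv_Cons)
qed simp

lemma tuple_star_shifts_in_mu_tensor:
  assumes "list_all2 (\<lambda>a U. a \<in> mu 1 U) as Us" "length Ss = length Us" "Ss \<noteq> []"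
    and "\<forall>S\<in>set (butlast Ss). completely_coherent S"
  shows "tuple (star_shifts as) \<in> mu (length Ss) (tensor Ss Us)"
  using assms
proof (induction Ss arbitrary: as Us)
  case (Cons S Ss)
  obtain U Us' where Us: "Us = U # Us'" "length Ss = length Us'"
    using Cons.prems(2) by (cases Us) auto
  then obtain a as' where as: "as = a # as'" "a \<in> mu 1 U" "list_all2 (\<lambda>a U. a \<in> mu 1 U) as' Us'"
    using Cons.prems(1) by (auto simp: list_all2_Cons2)
  show ?case
  proof (cases "Ss = []")
    case True
    then show ?thesis
      using Us as mu_subset_mu_tensor_singleton by auto
  next
    case False
    let ?t = "tuple (star_shifts as')"
    have "as' \<noteq> []"
      using False Us(2) as(3) by auto
    then have "tuple (star_shifts as) = vpair a (iter_star 1 ?t)"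
      by (simp add: as(1) tuple_Cons star_tuple)
    moreover have "?t \<in> mu (length Ss) (tensor Ss Us')"
      using Cons.IH[OF as(3) Us(2) False] Cons.prems(4) False by simp
    then have "vpair a (iter_star 1 ?t) \<in> mu (1 + length Ss) (tensor (S # Ss) (U # Us'))"
      using Cons.prems(4) False Us(2) as(2) by (intro vpair_in_mu_tensor_Cons) simp_all
    ultimately show ?thesis
      by (simp add: Us(1))
  qed
qed simp

end

theorem theorem4p29:
  fixes X :: "'v set" and elts :: "'v \<Rightarrow> 'v set" and star :: "'v \<Rightarrow> 'v"
    and k :: nat and S U \<alpha> :: "nat \<Rightarrow> 'v"
  assumes "single_superstructure_model X elts star"
    and "k \<ge> 1"
    and "\<And>i. i \<in> {1..k + 1} \<Longrightarrow> atoms_and_members.is_set X (S i)"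
    and "\<And>i. i \<in> {1..k} \<Longrightarrow>
           single_superstructure_model.completely_coherent X elts star (S i)"
    and "\<And>i. i \<in> {1..k + 1} \<Longrightarrow> U i \<in> superstructure.beta X elts (S i)"
    and "\<And>i. i \<in> {1..k + 1} \<Longrightarrow> \<alpha> i \<in> single_superstructure_model.mu elts star 1 (U i)"
  shows "superstructure.tuple X elts
           (map (\<lambda>i. single_superstructure_model.iter_star star (i - 1) (\<alpha> i)) [1..<k + 2])
         \<in> single_superstructure_model.mu elts star (k + 1)
             (superstructure.tensor X elts (map S [1..<k + 2]) (map U [1..<k + 2]))"
proof -
  interpret single_superstructure_model X elts star by fact
  let ?I = "[1..<k + 2]"
  have "list_all2 (\<lambda>a U. a \<in> mu 1 U) (map \<alpha> ?I) (map U ?I)"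
    using assms(6) by (auto simp: list_all2_conv_all_nth simp del: upt_Suc)
  moreover have "\<forall>Y\<in>set (butlast (map S ?I)). completely_coherent Y"
    using assms(4) by (auto simp flip: map_butlast)
  ultimately have "tuple (star_shifts (map \<alpha> ?I))
      \<in> mu (length (map S ?I)) (tensor (map S ?I) (map U ?I))"
    by (intro tuple_star_shifts_in_mu_tensor) simp_all
  then show ?thesis
    unfolding star_shifts_map_upt by (simp del: upt_Suc)
qed

end
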